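(* Let $d$ be a positive integer. No misaligned total order on $[d+1]\times[d+2]$ is realizable in $\mathbb{R}^d$.
   Context: Notation: for a positive integer $n$, $[n]=\{0,1,\dots,n-1\}$. A set of points in $\mathbb{R}^d$ is in general position if no $d+1$ of its elements lie on the same hyperplane. Realizability: let $n\le m$ and $d$ be positive integers with $n\ge 2$. Let $P=\{p_0,\dots,p_{n-1}\}$ and $Q=\{q_0,\dots,q_{m-1}\}$ be sets of points in $\mathbb{R}^d$ (of sizes $n$ and $m$), each in general position, such that every pair of points in $P\times Q$ determines a unique distance, i.e. the $nm$ distances $\|p_i-q_j\|$ (Euclidean norm), $(i,j)\in[n]\times[m]$, are pairwise distinct. Then $P$ and $Q$ induce the total order on $[n]\times[m]$ given by $(i,j)<(k,l)\iff \|p_i-q_j\|<\|p_k-q_l\|$. A total order on $[n]\times[m]$ is realizable in $\mathbb{R}^d$ if there exist such $P,Q\subset\mathbb{R}^d$ which induce this order. Misaligned orders: let $d$ be a positive integer. A total order $<$ on $[d+1]\times[d+2]$ is misaligned if the following three properties hold, where first coordinates are taken modulo $d+1$ and second coordinates are taken modulo $d+2$: 1. $(k,k)<(k,k-1)<\dots<(k,k-d-1)$ for all $k\in[d+1]$ (a chain through all $d+2$ elements of row $k$); 2. $(k,k)<(k+1,k)<\dots<(k+d,k)$ for all $k\in[d+1]$ (a chain through all $d+1$ elements of column $k$); 3. $(d,d+1)<(d-1,d+1)<\dots<(0,d+1)$. *)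

theory Defs
  imports "HOL-Analysis.Analysis"
begin

text \<open>
  The Euclidean space of dimension \<open>d\<close> is \<open>real ^ 'd\<close> with \<open>d = CARD('d)\<close>, and \<open>[n]\<close> is \<open>{..<n}\<close>.
  A total order \<open><\<close> on \<open>[n] \<times> [m]\<close> is represented by its strict part, a relation \<open>r\<close> with
  \<open>(x, y) \<in> r\<close> iff \<open>x < y\<close>.  The first conjunct below is needed because
  \<open>strict_linear_order_on A r\<close> does not confine \<open>r\<close> to \<open>A \<times> A\<close>.
\<close>

definition total_order_on_grid :: "nat \<Rightarrow> nat \<Rightarrow> (nat \<times> nat) rel \<Rightarrow> bool" where
  "total_order_on_grid n m r \<longleftrightarrow>
     r \<subseteq> ({..<n} \<times> {..<m}) \<times> ({..<n} \<times> {..<m}) \<and>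
     strict_linear_order_on ({..<n} \<times> {..<m}) r"

definition general_position :: "(real ^ 'd) set \<Rightarrow> bool" where
  "general_position S \<longleftrightarrow>
     (\<forall>T\<subseteq>S. card T = CARD('d) + 1 \<longrightarrow> \<not> (\<exists>a b. a \<noteq> 0 \<and> T \<subseteq> {x. a \<bullet> x = b}))"

definition induced_order ::
    "nat \<Rightarrow> nat \<Rightarrow> (nat \<Rightarrow> real ^ 'd) \<Rightarrow> (nat \<Rightarrow> real ^ 'd) \<Rightarrow> (nat \<times> nat) rel" where
  "induced_order n m p q =
     {((i, j), (k, l)). i < n \<and> j < m \<and> k < n \<and> l < m \<and>
        norm (p i - q j) < norm (p k - q l)}"

text \<open>
  The points are enumerated by \<open>p\<close> and \<open>q\<close>, whose values outside \<open>{..<n}\<close> and \<open>{..<m}\<close> are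
  irrelevant; the first two injectivity conditions say that the point sets have sizes \<open>n\<close> and \<open>m\<close>.
\<close>

definition realizable :: "'d::finite itself \<Rightarrow> nat \<Rightarrow> nat \<Rightarrow> (nat \<times> nat) rel \<Rightarrow> bool" where
  "realizable _ n m r \<longleftrightarrow>
     (\<exists>p q :: nat \<Rightarrow> real ^ 'd.
        inj_on p {..<n} \<and> inj_on q {..<m} \<and>
        general_position (p ` {..<n}) \<and> general_position (q ` {..<m}) \<and>
        inj_on (\<lambda>(i, j). norm (p i - q j)) ({..<n} \<times> {..<m}) \<and>
        r = induced_order n m p q)"

text \<open>
  Each chain is given by its consecutive comparisons, indexed by \<open>t\<close> or \<open>i\<close>.  The residue of
  \<open>k - t\<close> modulo \<open>d + 2\<close> is written \<open>(k + (d + 2) - t) mod (d + 2)\<close>, so that the subtraction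
  on naturals never truncates.
\<close>

definition misaligned :: "nat \<Rightarrow> (nat \<times> nat) rel \<Rightarrow> bool" where
  "misaligned d r \<longleftrightarrow>
     total_order_on_grid (d + 1) (d + 2) r \<and>
     (\<forall>k<d + 1. \<forall>t<d + 1.
        ((k, (k + (d + 2) - t) mod (d + 2)), (k, (k + (d + 2) - (t + 1)) mod (d + 2))) \<in> r) \<and>
     (\<forall>k<d + 1. \<forall>t<d.
        (((k + t) mod (d + 1), k), ((k + (t + 1)) mod (d + 1), k)) \<in> r) \<and>
     (\<forall>i<d. ((i + 1, d + 1), (i, d + 1)) \<in> r)"

end

theory Submission
  imports Defs
begin

text \<open>
  The \<open>d + 2\<close> points \<open>q\<^sub>j\<close> of \<open>d\<close>-dimensional space are affinely dependent: there are
  coefficients \<open>\<lambda>\<^sub>j\<close>, not all zero, with \<open>\<Sum>\<lambda>\<^sub>j = 0\<close> and \<open>\<Sum>\<lambda>\<^sub>j q\<^sub>j = 0\<close>.  Then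
  \<open>\<Sum>\<^sub>j \<lambda>\<^sub>j \<parallel>x - q\<^sub>j\<parallel>\<^sup>2\<close> has the same value \<open>C = \<Sum>\<lambda>\<^sub>j \<parallel>q\<^sub>j\<parallel>\<^sup>2\<close> for every point \<open>x\<close>
  (\<open>affine_dependence_sum_dist2\<close>).  For a realization of a misaligned order, \<open>C\<close> turns out to be
  negative (\<open>misaligned_dependence_negative\<close>); but \<open>-\<lambda>\<close> is a dependence as well, with value
  \<open>-C\<close>, and this is the contradiction.

  To see that \<open>C < 0\<close>, evaluate \<open>C\<close> at \<open>x = p\<^sub>k\<close>.  The distances from \<open>p\<^sub>k\<close> increase along row \<open>k\<close>
  read cyclically backwards from \<open>q\<^sub>k\<close>, so by summation by parts \<open>C < 0\<close> as soon as all partial sums of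
  \<open>\<lambda>\<close> in that reading are nonnegative (\<open>cyclic_weighted_sum_negative\<close>).  As in the cycle lemma,
  this holds if \<open>k\<close> is chosen so that \<open>\<lambda>\<^sub>0 + \<dots> + \<lambda>\<^sub>k\<close> is the largest prefix sum.  There is no row
  \<open>d + 1\<close>, so the choice fails exactly if the prefix sums for \<open>k \<le> d\<close> are all negative; in
  particular \<open>\<lambda>\<^sub>0 < 0 < \<lambda>\<^bsub>d+1\<^esub>\<close>.  In this case the column conditions, a sign pattern like that of
  a graph Laplacian, force all of \<open>\<lambda>\<^sub>0, \<dots>, \<lambda>\<^sub>d\<close> to be negative
  (\<open>cyclic_columns_force_negative\<close>).  Hence \<open>q\<^bsub>d+1\<^esub>\<close> is a convex combination of the other points
  of \<open>q\<close> and cannot be farther from \<open>p\<^sub>d\<close> than all of them, although row \<open>d\<close> says that it is.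
\<close>

text \<open>
  Summation by parts turns the weighted sum into minus a sum of products of partial sums of \<open>w\<close> and
  increments of \<open>f\<close>.
\<close>

lemma weighted_sum_negative_if_partial_sums_nonneg:
  fixes f w :: "nat \<Rightarrow> real"
  assumes incr: "\<And>t. t < m \<Longrightarrow> f t < f (Suc t)"
    and total: "(\<Sum>t\<le>m. w t) = 0"
    and partial: "\<And>s. s \<le> m \<Longrightarrow> 0 \<le> (\<Sum>t\<le>s. w t)"
    and nz: "\<exists>t\<le>m. w t \<noteq> 0"
  shows "(\<Sum>t\<le>m. w t * f t) < 0"
proof -
  define W where "W s = (\<Sum>t\<le>s. w t)" for s
  have abel: "(\<Sum>t\<le>l. w t * f t) = W l * f l - (\<Sum>t<l. W t * (f (Suc t) - f t))" for l
    by (induction l) (auto simp: W_def algebra_simps)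
  have "\<exists>t<m. W t \<noteq> 0"
  proof (rule ccontr)
    assume "\<not> (\<exists>t<m. W t \<noteq> 0)"
    then have W0: "W t = 0" if "t \<le> m" for t
      using that total unfolding W_def by (cases "t = m") auto
    have "w t = 0" if "t \<le> m" for t
    proof (cases t)
      case 0
      then show ?thesis using W0[of 0] by (simp add: W_def)
    next
      case (Suc u)
      then show ?thesis using W0[of t] W0[of u] that by (simp add: W_def)
    qed
    with nz show False by blast
  qed
  then obtain s where s: "s < m" "W s \<noteq> 0" by blast
  have "0 < (\<Sum>t<m. W t * (f (Suc t) - f t))"
  proof (rule sum_pos2[of _ s])
    show "0 < W s * (f (Suc s) - f s)"
      using s incr[of s] partial[of s] by (auto simp: W_def less_le)
    show "0 \<le> W t * (f (Suc t) - f t)" if "t \<in> {..<m}" for t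
      using that incr[of t] partial[of t] by (auto simp: W_def)
  qed (use s in auto)
  moreover have "W m = 0" using total by (simp add: W_def)
  ultimately show ?thesis by (simp add: abel)
qed

lemma sum_cyclic_backwards:
  fixes g :: "nat \<Rightarrow> 'a::comm_monoid_add"
  assumes "k < n"
  shows "(\<Sum>t<n. g ((k + n - t) mod n)) = (\<Sum>j<n. g j)"
proof (rule sum.reindex_bij_witness[of _ "\<lambda>j. (k + n - j) mod n" "\<lambda>t. (k + n - t) mod n"])
  have inv: "(k + n - (k + n - t) mod n) mod n = t" if "t < n" for t
  proof (cases "t \<le> k")
    case True
    then have "(k + n - t) mod n = k - t" using assms
      by (metis Nat.add_diff_assoc2 mod_add_self2 mod_less less_imp_diff_less)
    then show ?thesis using True that by simp
  next
    case False
    then have "(k + n - t) mod n = k + n - t" using that by simp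
    then show ?thesis using False that by simp
  qed
  show "(k + n - (k + n - t) mod n) mod n = t" if "t \<in> {..<n}" for t using inv that by simp
  show "(k + n - (k + n - j) mod n) mod n = j" if "j \<in> {..<n}" for j using inv that by simp
qed (use assms in auto)

text \<open>
  Read backwards from \<open>k\<close>, a partial sum of \<open>c\<close> is the prefix sum ending with \<open>c k\<close> minus
  another prefix sum; when the reading wraps around, this uses that the total vanishes.
\<close>

lemma cyclic_weighted_sum_negative:
  fixes f c :: "nat \<Rightarrow> real"
  assumes k: "k \<le> m"
    and incr: "\<And>t. t < m \<Longrightarrow>
      f ((k + Suc m - t) mod Suc m) < f ((k + Suc m - Suc t) mod Suc m)"
    and total: "(\<Sum>j\<le>m. c j) = 0"
    and max: "\<And>l. l \<le> m \<Longrightarrow> (\<Sum>j<l. c j) \<le> (\<Sum>j\<le>k. c j)"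
    and nz: "\<exists>j\<le>m. c j \<noteq> 0"
  shows "(\<Sum>j\<le>m. c j * f j) < 0"
proof -
  define n where "n = Suc m"
  define H where "H l = (\<Sum>j<l mod n. c j)" for l
  have npos: "0 < n" by (simp add: n_def)
  have lt: "{..<n} = {..m}" by (auto simp: n_def)
  have "k < n" using k by (simp add: n_def)
  from sum_cyclic_backwards[OF this] have cyc:
      "(\<Sum>t\<le>m. g ((k + n - t) mod n)) = (\<Sum>j\<le>m. g j)" for g :: "nat \<Rightarrow> real"
    by (simp only: lt)
  have H_Suc: "H (Suc l) = H l + c (l mod n)" for l
  proof (cases "Suc (l mod n) = n")
    case True
    then have "l mod n = m" by (simp add: n_def)
    then have "H l + c (l mod n) = (\<Sum>j<Suc m. c j)" by (simp add: H_def)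
    also have "\<dots> = 0" using total by (simp add: lessThan_Suc_atMost)
    finally show ?thesis using True by (simp add: H_def mod_Suc)
  next
    case False
    then show ?thesis by (simp add: H_def mod_Suc)
  qed
  have part: "(\<Sum>t<s. c ((k + n - t) mod n)) = H (Suc (k + n)) - H (Suc (k + n) - s)"
    if "s \<le> n" for s
    using that
  proof (induction s)
    case (Suc s)
    then have "Suc (k + n) - s = Suc (k + n - s)" by simp
    then show ?case using Suc H_Suc[of "k + n - s"] by simp
  qed simp
  have top: "H (Suc (k + n)) = (\<Sum>j\<le>k. c j)"
  proof -
    have km: "(k + n) mod n = k" using \<open>k < n\<close> by simp
    have "H (Suc (k + n)) = H (k + n) + c k" using H_Suc[of "k + n"] by (simp only: km)
    also have "\<dots> = (\<Sum>j\<le>k. c j)"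
      by (simp only: H_def km) (simp flip: lessThan_Suc_atMost)
    finally show ?thesis .
  qed
  have "(\<Sum>t\<le>m. c ((k + n - t) mod n) * f ((k + n - t) mod n)) < 0"
  proof (rule weighted_sum_negative_if_partial_sums_nonneg)
    show "f ((k + n - t) mod n) < f ((k + n - Suc t) mod n)" if "t < m" for t
      using incr[OF that] by (simp only: n_def)
    show "(\<Sum>t\<le>m. c ((k + n - t) mod n)) = 0"
      using cyc[of c] total by simp
    show "0 \<le> (\<Sum>t\<le>s. c ((k + n - t) mod n))" if "s \<le> m" for s
    proof -
      have "H l \<le> (\<Sum>j\<le>k. c j)" for l
        using max[of "l mod n"] mod_less_divisor[OF npos, of l] by (simp add: H_def n_def)
      then show ?thesis
        using part[of "Suc s"] that top by (simp add: n_def lessThan_Suc_atMost)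
    qed
    show "\<exists>t\<le>m. c ((k + n - t) mod n) \<noteq> 0"
    proof (rule ccontr)
      assume "\<not> ?thesis"
      then have "(\<Sum>t\<le>m. \<bar>c ((k + n - t) mod n)\<bar>) = 0" by simp
      then have "(\<Sum>j\<le>m. \<bar>c j\<bar>) = 0"
        using cyc[of "\<lambda>j. \<bar>c j\<bar>"] by simp
      with nz show False by (auto simp: sum_nonneg_eq_0_iff)
    qed
  qed
  then show ?thesis
    using cyc[of "\<lambda>j. c j * f j"] by simp
qed

text \<open>
  Among the cyclic differences of a column \<open>j \<le> d\<close> of \<open>F\<close>, only the one entering row \<open>j\<close> is
  negative, and they add up to zero, as in the generator matrix of a Markov chain.  Let \<open>J\<close> be the
  set of columns \<open>j \<le> d\<close> with \<open>c j \<ge> 0\<close>, which omits \<open>0\<close>, and add the relations \<open>balance\<close> for the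
  steps entering a row in \<open>J\<close>; in the proof these steps are indexed by the rows \<open>i \<in> I\<close> that they leave.
  A column in \<open>J\<close> then contributes a negative sum of differences with a nonnegative weight, a column
  outside \<open>J\<close> a positive one with a negative weight, and the last column is strictly negative.
\<close>

lemma cyclic_columns_force_negative:
  fixes F :: "nat \<Rightarrow> nat \<Rightarrow> real" and c :: "nat \<Rightarrow> real"
  assumes up: "\<And>i j. i < d \<Longrightarrow> j \<le> d \<Longrightarrow> j \<noteq> Suc i \<Longrightarrow> F i j < F (Suc i) j"
    and wrap: "\<And>j. 0 < j \<Longrightarrow> j \<le> d \<Longrightarrow> F d j < F 0 j"
    and down: "\<And>i. i < d \<Longrightarrow> F (Suc i) (Suc d) < F i (Suc d)"
    and balance: "\<And>i. i < d \<Longrightarrow> (\<Sum>j\<le>Suc d. c j * (F (Suc i) j - F i j)) = 0"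
    and first: "c 0 < 0" and last: "0 < c (Suc d)"
    and "j \<le> d"
  shows "c j < 0"
proof (rule ccontr)
  assume "\<not> c j < 0"
  define I where "I = {i. i < d \<and> 0 \<le> c (Suc i)}"
  have finI: "finite I" and I_sub: "I \<subseteq> {..<d}" by (auto simp: I_def)
  obtain i0 where "j = Suc i0" using \<open>\<not> c j < 0\<close> first by (cases j) auto
  then have I_ne: "I \<noteq> {}" using \<open>\<not> c j < 0\<close> \<open>j \<le> d\<close> by (auto simp: I_def intro!: exI[of _ i0])
  define S where "S j = (\<Sum>i\<in>I. F (Suc i) j - F i j)" for j
  have S_last: "S (Suc d) < 0"
  proof -
    have "0 < (\<Sum>i\<in>I. F i (Suc d) - F (Suc i) (Suc d))"
      using finI I_ne down by (intro sum_pos) (auto simp: I_def)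
    then show ?thesis by (simp add: S_def sum_subtractf)
  qed
  have col: "c j * S j \<le> 0" if "j \<le> d" for j
  proof (cases "0 \<le> c j")
    case True
    with first have "j \<noteq> 0" by (cases j) auto
    have "(\<Sum>i<d. F (Suc i) j - F i j) = F d j - F 0 j"
      by (rule sum_lessThan_telescope)
    then have "S j + (\<Sum>i\<in>{..<d} - I. F (Suc i) j - F i j) = F d j - F 0 j"
      using sum.subset_diff[OF I_sub finite_lessThan, of "\<lambda>i. F (Suc i) j - F i j"]
      by (simp add: S_def add.commute)
    moreover have "0 \<le> (\<Sum>i\<in>{..<d} - I. F (Suc i) j - F i j)"
    proof (rule sum_nonneg)
      fix i assume i: "i \<in> {..<d} - I"
      then have "j \<noteq> Suc i" using True by (auto simp: I_def)
      then show "0 \<le> F (Suc i) j - F i j" using i up[of i j] that by simp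
    qed
    ultimately have "S j \<le> 0" using wrap[of j] that \<open>j \<noteq> 0\<close> by simp
    then show ?thesis using True by (simp add: mult_nonneg_nonpos)
  next
    case False
    have "0 \<le> S j"
      unfolding S_def
    proof (rule sum_nonneg)
      fix i assume "i \<in> I"
      then show "0 \<le> F (Suc i) j - F i j"
        using False up[of i j] that by (cases "j = Suc i") (auto simp: I_def)
    qed
    then show ?thesis using False by (simp add: mult_nonpos_nonneg)
  qed
  have "0 = (\<Sum>i\<in>I. \<Sum>j\<le>Suc d. c j * (F (Suc i) j - F i j))"
    using balance by (simp add: I_def)
  also have "\<dots> = (\<Sum>j\<le>Suc d. c j * S j)"
    by (subst sum.swap) (simp only: S_def sum_distrib_left)
  also have "\<dots> = (\<Sum>j\<le>d. c j * S j) + c (Suc d) * S (Suc d)" by simp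
  also have "\<dots> < 0"
    using sum_nonpos[of "{..d}" "\<lambda>j. c j * S j"] col mult_pos_neg[OF last S_last] by simp
  finally show False by simp
qed

text \<open>
  Expanding the squares, the terms that involve \<open>x\<close> are multiples of the two vanishing sums.
\<close>

lemma affine_dependence_sum_dist2:
  fixes q :: "'i \<Rightarrow> 'a::real_inner"
  assumes "(\<Sum>j\<in>A. c j) = 0" and "(\<Sum>j\<in>A. c j *\<^sub>R q j) = 0"
  shows "(\<Sum>j\<in>A. c j * (norm (x - q j))\<^sup>2) = (\<Sum>j\<in>A. c j * (norm (q j))\<^sup>2)"
proof -
  have "(\<Sum>j\<in>A. c j * (norm (x - q j))\<^sup>2) =
      (\<Sum>j\<in>A. c j * (norm x)\<^sup>2 - 2 * (x \<bullet> (c j *\<^sub>R q j)) + c j * (norm (q j))\<^sup>2)"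
    by (rule sum.cong) (auto simp: power2_norm_eq_inner inner_diff inner_commute algebra_simps)
  also have "\<dots> = (\<Sum>j\<in>A. c j) * (norm x)\<^sup>2 - 2 * (x \<bullet> (\<Sum>j\<in>A. c j *\<^sub>R q j)) +
      (\<Sum>j\<in>A. c j * (norm (q j))\<^sup>2)"
    by (simp add: sum.distrib sum_subtractf sum_distrib_left sum_distrib_right inner_sum_right)
  finally show ?thesis using assms by simp
qed

lemma norm_convex_combination_less:
  fixes v :: "'i \<Rightarrow> 'a::real_normed_vector"
  assumes fin: "finite A" and pos: "\<And>j. j \<in> A \<Longrightarrow> 0 < a j"
    and coeff: "(\<Sum>j\<in>A. a j) = b" "0 < b"
    and comb: "b *\<^sub>R y = (\<Sum>j\<in>A. a j *\<^sub>R v j)"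
    and less: "\<And>j. j \<in> A \<Longrightarrow> norm (v j) < R"
  shows "norm y < R"
proof -
  have ne: "A \<noteq> {}" using coeff by auto
  have "b * norm y = norm (\<Sum>j\<in>A. a j *\<^sub>R v j)"
    using coeff(2) by (simp flip: comb)
  also have "\<dots> \<le> (\<Sum>j\<in>A. norm (a j *\<^sub>R v j))" by (rule norm_sum)
  also have "\<dots> < (\<Sum>j\<in>A. a j * R)"
  proof (rule sum_strict_mono[OF fin ne])
    show "norm (a j *\<^sub>R v j) < a j * R" if "j \<in> A" for j
      using pos[OF that] less[OF that] by simp
  qed
  also have "\<dots> = b * R" using coeff(1) by (simp flip: sum_distrib_right)
  finally show ?thesis using coeff(2) by simp
qed

text \<open>
  If a prefix sum ending at some \<open>k \<le> d\<close> is nonnegative, then the largest of these is also at least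
  the empty and the full prefix sum, both zero, and row \<open>k\<close> gives the claim.  Otherwise
  \<open>q (Suc d)\<close> lies in the convex hull of the other points of \<open>q\<close>, which contradicts row \<open>d\<close>.
\<close>

lemma misaligned_dependence_negative:
  fixes p q :: "nat \<Rightarrow> 'a::real_inner" and c :: "nat \<Rightarrow> real"
  defines "D \<equiv> \<lambda>i j. norm (p i - q j)"
  assumes row: "\<And>k t. k \<le> d \<Longrightarrow> t \<le> d \<Longrightarrow>
      D k ((k + Suc (Suc d) - t) mod Suc (Suc d)) < D k ((k + Suc (Suc d) - Suc t) mod Suc (Suc d))"
    and up: "\<And>i j. i < d \<Longrightarrow> j \<le> d \<Longrightarrow> j \<noteq> Suc i \<Longrightarrow> D i j < D (Suc i) j"
    and wrap: "\<And>j. 0 < j \<Longrightarrow> j \<le> d \<Longrightarrow> D d j < D 0 j"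
    and down: "\<And>i. i < d \<Longrightarrow> D (Suc i) (Suc d) < D i (Suc d)"
    and total: "(\<Sum>j\<le>Suc d. c j) = 0"
    and dep: "(\<Sum>j\<le>Suc d. c j *\<^sub>R q j) = 0"
    and nz: "\<exists>j\<le>Suc d. c j \<noteq> 0"
  shows "(\<Sum>j\<le>Suc d. c j * (norm (q j))\<^sup>2) < 0"
proof -
  have const: "(\<Sum>j\<le>Suc d. c j * (D i j)\<^sup>2) = (\<Sum>j\<le>Suc d. c j * (norm (q j))\<^sup>2)" for i
    unfolding D_def by (rule affine_dependence_sum_dist2[OF total dep])
  have sq: "x < y \<Longrightarrow> x\<^sup>2 < y\<^sup>2" if "x = D i j" for x y i j
    using that by (intro power_strict_mono) (auto simp: D_def)
  define G where "G k = (\<Sum>j\<le>k. c j)" for k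
  have "Max (G ` {..d}) \<in> G ` {..d}" by (intro Max_in) auto
  then obtain k where k: "k \<le> d" "G k = Max (G ` {..d})"
    by (metis (no_types) imageE atMost_iff)
  then have G_le: "G l \<le> G k" if "l \<le> d" for l using that by simp
  show ?thesis
  proof (cases "0 \<le> G k")
    case True
    have "(\<Sum>j\<le>Suc d. c j * (D k j)\<^sup>2) < 0"
    proof (rule cyclic_weighted_sum_negative[of k])
      show "(\<Sum>j<l. c j) \<le> (\<Sum>j\<le>k. c j)" if "l \<le> Suc d" for l
        using that G_le[of "l - 1"] True
        by (cases l) (auto simp: G_def lessThan_Suc_atMost)
      show "(D k ((k + Suc (Suc d) - t) mod Suc (Suc d)))\<^sup>2
          < (D k ((k + Suc (Suc d) - Suc t) mod Suc (Suc d)))\<^sup>2" if "t < Suc d" for t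
        using row[of k t] k that by (intro sq[OF refl]) simp
    qed (use k total nz in auto)
    then show ?thesis by (simp only: const)
  next
    case False
    then have neg: "G l < 0" if "l \<le> d" for l using G_le[OF that] by simp
    have first: "c 0 < 0" using neg[of 0] by (simp add: G_def)
    have last: "0 < c (Suc d)" using neg[of d] total by (simp add: G_def)
    have c_neg: "c j < 0" if "j \<le> d" for j
    proof (rule cyclic_columns_force_negative[of d "\<lambda>i j. (D i j)\<^sup>2"])
      show "(\<Sum>j\<le>Suc d. c j * ((D (Suc i) j)\<^sup>2 - (D i j)\<^sup>2)) = 0" for i
        using const[of i] const[of "Suc i"] by (simp only: right_diff_distrib sum_subtractf)
    qed (use that first last up wrap down sq in auto)
    \<comment> \<open>In row \<open>d\<close> the backward reading visits \<open>d, d - 1, \<dots>, 0\<close> and then \<open>d + 1\<close>.\<close>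
    have far: "D d j < D d (Suc d)" if "j \<le> d" for j
    proof -
      have "D d j < D d (Suc d)" if "j = d - t" "t \<le> d" for t
        using that
      proof (induction "d - t" arbitrary: t j)
        case 0
        then have "t = d" by simp
        with 0 row[of d d] show ?case by simp
      next
        case (Suc u)
        have eq: "(d + Suc (Suc d) - s) mod Suc (Suc d) = d - s" if "s \<le> d" for s
        proof -
          have "d + Suc (Suc d) - s = (d - s) + Suc (Suc d)" using that by simp
          then show ?thesis by (simp only: mod_add_self2) simp
        qed
        have "D d (d - t) < D d (d - Suc t)"
          using row[of d t] eq[of t] eq[of "Suc t"] Suc.hyps(2) by simp
        also have "\<dots> < D d (Suc d)"
          using Suc.hyps by (intro Suc.hyps(1)[of "Suc t"]) auto
        finally show ?case using Suc.prems by simp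
      qed
      from this[of "d - j"] that show ?thesis by simp
    qed
    have "norm (p d - q (Suc d)) < D d (Suc d)"
    proof (rule norm_convex_combination_less[of "{..d}" "\<lambda>j. - c j" "c (Suc d)" _ "\<lambda>j. p d - q j"])
      have tot: "c (Suc d) = - (\<Sum>j\<le>d. c j)" using total by simp
      have "c (Suc d) *\<^sub>R q (Suc d) = - (\<Sum>j\<le>d. c j *\<^sub>R q j)"
        using dep by (simp add: eq_neg_iff_add_eq_0 add.commute)
      then show "c (Suc d) *\<^sub>R (p d - q (Suc d)) = (\<Sum>j\<le>d. - c j *\<^sub>R (p d - q j))"
        by (simp add: scaleR_diff_right sum_subtractf sum_negf scaleR_sum_left tot)
      show "(\<Sum>j\<le>d. - c j) = c (Suc d)" by (simp add: tot sum_negf)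
    qed (use c_neg last far in \<open>auto simp: D_def\<close>)
    then show ?thesis by (simp add: D_def)
  qed
qed

lemma affine_dependence_of_many_points:
  fixes q :: "nat \<Rightarrow> 'a::euclidean_space"
  assumes inj: "inj_on q {..m}" and m: "DIM('a) < m"
  shows "\<exists>c. (\<Sum>j\<le>m. c j) = 0 \<and> (\<Sum>j\<le>m. c j *\<^sub>R q j) = 0 \<and> (\<exists>j\<le>m. c j \<noteq> (0::real))"
proof -
  have "card (q ` {..m}) = Suc m" using card_image[OF inj] by simp
  then have "affine_dependent (q ` {..m})"
    using m by (intro affine_dependent_biggerset) auto
  then obtain u where u: "sum u (q ` {..m}) = 0" "\<exists>v\<in>q ` {..m}. u v \<noteq> 0"
      "(\<Sum>v\<in>q ` {..m}. u v *\<^sub>R v) = 0"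
    by (auto simp: affine_dependent_explicit_finite)
  show ?thesis
    by (rule exI[of _ "u \<circ> q"]) (use u in \<open>auto simp: sum.reindex[OF inj] o_def\<close>)
qed

theorem theorem2:
  fixes r :: "(nat \<times> nat) rel"
  assumes "misaligned CARD('d::finite) r"
  shows "\<not> realizable TYPE('d) (CARD('d) + 1) (CARD('d) + 2) r"
proof
  assume "realizable TYPE('d) (CARD('d) + 1) (CARD('d) + 2) r"
  define d where "d = CARD('d)"
  from \<open>realizable _ _ _ _\<close> obtain p q :: "nat \<Rightarrow> real ^ 'd" where
    inj: "inj_on q {..<d + 2}" and r: "r = induced_order (d + 1) (d + 2) p q"
    unfolding realizable_def d_def by blast
  have dist: "norm (p i - q j) < norm (p k - q l)" if "((i, j), (k, l)) \<in> r" for i j k l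
    using that by (simp add: r induced_order_def)
  have row: "norm (p k - q ((k + Suc (Suc d) - t) mod Suc (Suc d)))
      < norm (p k - q ((k + Suc (Suc d) - Suc t) mod Suc (Suc d)))" if "k \<le> d" "t \<le> d" for k t
    using assms that unfolding misaligned_def d_def[symmetric] by (intro dist) simp
  have col: "norm (p ((j + t) mod Suc d) - q j) < norm (p ((j + Suc t) mod Suc d) - q j)"
    if "j \<le> d" "t < d" for j t
    using assms that unfolding misaligned_def d_def[symmetric] by (intro dist) simp
  have down: "norm (p (Suc i) - q (Suc d)) < norm (p i - q (Suc d))" if "i < d" for i
    using assms that unfolding misaligned_def d_def[symmetric] by (intro dist) simp
  have up: "norm (p i - q j) < norm (p (Suc i) - q j)" if "i < d" "j \<le> d" "j \<noteq> Suc i" for i j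
  proof (cases "j \<le> i")
    case True
    then show ?thesis using col[of j "i - j"] that by simp
  next
    case False
    then have "j + (i + Suc d - j) = i + Suc d" "j + Suc (i + Suc d - j) = Suc i + Suc d"
      using that by auto
    then have "(j + (i + Suc d - j)) mod Suc d = i" "(j + Suc (i + Suc d - j)) mod Suc d = Suc i"
      using that by (simp_all only: mod_add_self2 mod_less less_SucI Suc_less_eq)
    then show ?thesis using col[of j "i + Suc d - j"] that False by simp
  qed
  have wrap: "norm (p d - q j) < norm (p 0 - q j)" if "0 < j" "j \<le> d" for j
    using col[of j "d - j"] that by simp
  have inj': "inj_on q {..Suc d}" using inj by (simp add: lessThan_Suc_atMost)
  have "DIM(real ^ 'd) < Suc d" by (simp add: d_def)
  from affine_dependence_of_many_points[OF inj' this] obtain c where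
    c: "(\<Sum>j\<le>Suc d. c j) = 0" "(\<Sum>j\<le>Suc d. c j *\<^sub>R q j) = 0" "\<exists>j\<le>Suc d. c j \<noteq> 0"
    by blast
  have "(\<Sum>j\<le>Suc d. c j * (norm (q j))\<^sup>2) < 0"
    by (rule misaligned_dependence_negative[OF row up wrap down c])
  moreover have "(\<Sum>j\<le>Suc d. - c j * (norm (q j))\<^sup>2) < 0"
  proof (rule misaligned_dependence_negative[OF row up wrap down])
    show "(\<Sum>j\<le>Suc d. - c j) = 0" using c(1) by (simp only: sum_negf minus_zero)
    show "(\<Sum>j\<le>Suc d. - c j *\<^sub>R q j) = 0" using c(2) by (simp only: scaleR_minus_left sum_negf minus_zero)
    show "\<exists>j\<le>Suc d. - c j \<noteq> 0" using c(3) by simp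
  qed
  ultimately show False by (simp only: mult_minus_left sum_negf)
qed

end
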